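(* Let $s\in\mathbb C$ and $\delta>0$ be fixed. Then the alternating Hurwitz zeta function has the asymptotic expansion $$\zeta_E(s,q)\sim\frac12 q^{-s}+\frac14 s\,q^{-s-1}-\frac12 q^{-s}\sum_{k=1}^\infty\frac{E_{2k+1}(0)}{(2k+1)!}\frac{(s)_{2k+1}}{q^{2k+1}}$$ as $|q|\to\infty$ in the sector $|\arg q|\le\pi-\delta$.
   Context: For $|\arg q|<\pi$, $\zeta_E(s,q)$ denotes the alternating Hurwitz zeta function, defined for $\mathrm{Re}(s)>0$ by $\zeta_E(s,q)=\sum_{n=0}^\infty \frac{(-1)^n}{(n+q)^s}$ (principal branches) and extended to an entire function of $s\in\mathbb C$ by analytic continuation. $E_n(x)$ are the Euler polynomials, $\frac{2e^{xt}}{e^t+1}=\sum_{n\ge0}E_n(x)\frac{t^n}{n!}$ for $|t|<\pi$. $(s)_k=s(s+1)\cdots(s+k-1)$, $(s)_0=1$, is the Pochhammer symbol. Powers $q^{-s}$ are principal values. The symbol $\sim$ means asymptotic expansion in the Poincaré sense: for each integer $K\ge0$, the difference between the left side and the right side with the infinite series truncated after $k=K$ is $O(|q|^{-\mathrm{Re}(s)-2K-3})$ as $|q|\to\infty$ in the sector, the implied constant depending only on $s,\delta,K$. *)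

theory Defs
  imports
    "HOL-Complex_Analysis.Complex_Analysis"
    "HOL-Library.Landau_Symbols"
begin

(* Coefficients of the generating function 2 e^(xt) / (e^t + 1), read as a formal power series
   in t; the denominator has constant term 2, so the quotient is a genuine one.
   Lemma euler_poly_sums gives the analytic form of the identity. *)
definition euler_poly :: "nat \<Rightarrow> complex \<Rightarrow> complex" where
  "euler_poly n x = fact n * fps_nth (2 * fps_exp x / (fps_exp 1 + 1)) n"

lemma euler_poly_sums:
  assumes "norm t < pi"
  shows "(\<lambda>n. euler_poly n x * t ^ n / fact n) sums (2 * exp (x * t) / (exp t + 1))"
proof -
  let ?f = "\<lambda>t. 2 * exp (x * t) / (exp (1 * t) + 1)"
  let ?F = "2 * fps_exp x / (fps_exp 1 + 1) :: complex fps"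
  have nz: "exp z + 1 \<noteq> 0" if "norm z < pi" for z :: complex
  proof
    assume "exp z + 1 = 0"
    then have "exp z = exp (\<i> * of_real pi)"
      by (simp add: add_eq_0_iff2)
    then obtain n :: int where "z = \<i> * of_real pi + of_int (2 * n) * of_real pi * \<i>"
      unfolding exp_eq by (auto simp: mult_ac)
    then have "Im z = pi * of_int (2 * n + 1)"
      by (simp add: algebra_simps)
    then have "\<bar>Im z\<bar> = pi * of_int \<bar>2 * n + 1\<bar>"
      by (simp add: abs_mult)
    moreover have "(1::real) \<le> of_int \<bar>2 * n + 1\<bar>"
      by (simp only: of_int_1_le_iff) presburger
    ultimately have "pi \<le> \<bar>Im z\<bar>"
      using mult_left_mono[of 1 "of_int \<bar>2 * n + 1\<bar>" pi] by simp
    with that abs_Im_le_cmod[of z] show False by simp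
  qed
  have "?f has_fps_expansion ?F"
    by (rule fps_expansion_intros | simp)+
  moreover have "?f holomorphic_on eball 0 (ereal pi)"
    by (intro holomorphic_intros) (use nz in auto)
  ultimately have "(\<lambda>n. fps_nth ?F n * t ^ n) sums ?f t"
    by (rule has_fps_expansion_imp_sums_complex) (use assms in simp)
  then show ?thesis
    by (simp add: euler_poly_def)
qed

(* For fixed q, the entire function of s that continues the alternating Hurwitz series.
   The series converges only conditionally for 0 < Re s <= 1, hence sums, not has_sum.
   For q off the non-positive real axis the continuation exists; it is unique by
   alt_hurwitz_zeta_eqI. For other q the value is irrelevant. *)
definition alt_hurwitz_zeta :: "complex \<Rightarrow> complex \<Rightarrow> complex" where
  "alt_hurwitz_zeta s q =
     (THE f. f holomorphic_on UNIV \<and>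
        (\<forall>z. Re z > 0 \<longrightarrow> (\<lambda>n. (-1) ^ n / (of_nat n + q) powr z) sums f z)) s"

lemma alt_hurwitz_zeta_eqI:
  assumes "f holomorphic_on UNIV"
    and "\<And>z. Re z > 0 \<Longrightarrow> (\<lambda>n. (-1) ^ n / (of_nat n + q) powr z) sums f z"
  shows "alt_hurwitz_zeta s q = f s"
proof -
  have "g = f" if g: "g holomorphic_on UNIV"
    "\<forall>z. Re z > 0 \<longrightarrow> (\<lambda>n. (-1) ^ n / (of_nat n + q) powr z) sums g z" for g
  proof (rule ext)
    fix w
    have op: "open {z. Re z > 0}"
      by (simp add: open_halfspace_Re_gt)
    show "g w = f w"
    proof (rule analytic_continuation_open[where f = g and g = f and z = w, OF op open_UNIV])
      show "{z. Re z > 0} \<noteq> {}"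
        by (auto intro: exI[of _ 1])
      show "g z = f z" if "z \<in> {z. Re z > 0}" for z
        using sums_unique2[OF g(2)[rule_format, of z] assms(2)[of z]] that by simp
    qed (use g assms(1) in auto)
  qed
  then have "(THE f. f holomorphic_on UNIV \<and>
        (\<forall>z. Re z > 0 \<longrightarrow> (\<lambda>n. (-1) ^ n / (of_nat n + q) powr z) sums f z)) = f"
    using assms by (intro the_equality conjI allI impI) blast+
  then show ?thesis
    by (simp add: alt_hurwitz_zeta_def)
qed

definition sector_at_infinity :: "real \<Rightarrow> complex filter" where
  "sector_at_infinity \<delta> = inf at_infinity (principal {q. \<bar>Arg q\<bar> \<le> pi - \<delta>})"

end

theory Submission
  imports Defs
begin

text \<open>Boole summation. With \<open>1 / (exp t + 1) = (\<Sum>k. c\<^sub>k * t ^ k)\<close> and \<open>f x = x powr (- s)\<close>, the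
  truncated operator \<open>T\<^sub>N = (\<Sum>k\<le>N. c\<^sub>k * f\<^sup>(\<^sup>k\<^sup>))\<close> solves \<open>T\<^sub>N x + T\<^sub>N (x + 1) = f x\<close> up to a
  remainder \<open>R\<^sub>N x\<close> of order \<open>x powr (- s - N - 1)\<close>. Telescoping the alternating series therefore gives
  \<open>T\<^sub>N q + (\<Sum>n. (-1) ^ n * R\<^sub>N (q + n))\<close>, where the last series converges locally uniformly for
  \<open>Re s > 1 - N\<close>; these expressions for varying \<open>N\<close> glue to the entire continuation. In the
  sector, \<open>|q + n|\<close> is comparable to \<open>|q| + n\<close>, so the series of remainders loses only a bounded
  power of \<open>q\<close>, which is absorbed by choosing \<open>N\<close> larger than the order of truncation requires.\<close>

section \<open>Coefficients of the Boole operator\<close>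

definition boole_coeff :: "nat \<Rightarrow> complex" where
  "boole_coeff k = euler_poly k 0 / (2 * fact k)"

lemma boole_coeff_conv_fps: "boole_coeff k = fps_nth (inverse (fps_exp 1 + 1)) k"
proof -
  have "2 * fps_exp 0 / (fps_exp 1 + 1) = 2 * (inverse (fps_exp 1 + 1) :: complex fps)"
    by (subst fps_divide_unit) (auto simp: fps_exp_0)
  also have "fps_nth \<dots> k = 2 * fps_nth (inverse (fps_exp 1 + 1)) k"
    by (simp add: numeral_fps_const)
  finally show ?thesis
    by (simp add: boole_coeff_def euler_poly_def)
qed

text \<open>Comparison of coefficients in \<open>G * exp t + G = 1\<close>, where \<open>G\<close>
  is the power series of \<open>1 / (exp t + 1)\<close>. This identity drives the cancellation
  between the operator at \<open>x\<close> and at \<open>x + 1\<close>.\<close>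

lemma boole_coeff_rec:
  "(\<Sum>k\<le>m. boole_coeff k / fact (m - k)) + boole_coeff m = (if m = 0 then 1 else 0)"
proof -
  let ?G = "inverse (fps_exp 1 + 1) :: complex fps"
  have "?G * fps_exp 1 + ?G = ?G * (fps_exp 1 + 1)"
    by (simp add: algebra_simps)
  also have "\<dots> = 1"
    by (rule inverse_mult_eq_1) simp
  finally have "fps_nth (?G * fps_exp 1) m + fps_nth ?G m = fps_nth 1 m"
    by (metis fps_add_nth)
  then show ?thesis
    by (simp add: fps_mult_nth boole_coeff_conv_fps atLeast0AtMost)
qed

lemma boole_coeff_0: "boole_coeff 0 = 1 / 2"
  using boole_coeff_rec[of 0] by (simp add: field_simps)

lemma boole_coeff_1: "boole_coeff (Suc 0) = - 1 / 4"
  using boole_coeff_rec[of 1] by (simp add: boole_coeff_0 field_simps eq_neg_iff_add_eq_0)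

text \<open>Since \<open>1 / (exp t + 1) + 1 / (exp (- t) + 1) = 1\<close>, the generating function is \<open>1 / 2\<close>
  plus an odd function.\<close>

lemma boole_coeff_even:
  assumes "even k" "k > 0"
  shows "boole_coeff k = 0"
proof -
  let ?E = "fps_exp 1 :: complex fps" and ?E' = "fps_exp (-1) :: complex fps"
  let ?G = "inverse (?E + 1)" and ?G' = "inverse (?E' + 1)"
  have EE: "?E * ?E' = 1"
    using fps_exp_add_mult[of "1::complex" "-1"] by simp
  have G: "?G * (?E + 1) = 1" "?G' * (?E' + 1) = 1"
    by (rule inverse_mult_eq_1; simp)+
  have "(?E + 1) * (?E' + 1) * (?G + ?G')
      = (?G * (?E + 1)) * (?E' + 1) + (?G' * (?E' + 1)) * (?E + 1)"
    by (simp add: algebra_simps)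
  also have "\<dots> = (?E' + 1) + (?E + 1)"
    by (simp only: G mult_1)
  also have "\<dots> = (?E + 1) * (?E' + 1)"
    using EE by (simp add: algebra_simps)
  finally have "?G * (?G' * ((?E + 1) * (?E' + 1) * (?G + ?G'))) = ?G * (?G' * ((?E + 1) * (?E' + 1)))"
    by simp
  moreover have "?G * (?G' * ((?E + 1) * (?E' + 1) * w)) = w" for w
  proof -
    have "?G * (?G' * ((?E + 1) * (?E' + 1) * w)) = (?G * (?E + 1)) * (?G' * (?E' + 1)) * w"
      by (simp only: mult_ac)
    then show ?thesis by (simp add: G)
  qed
  note this[of "?G + ?G'"] this[of 1]
  ultimately have sum1: "?G + ?G' = 1"
    by simp
  \<comment> \<open>Replacing \<open>t\<close> by \<open>- t\<close> multiplies the coefficient of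
    index \<open>k\<close> by \<open>(-1) ^ k\<close>, so for even \<open>k\<close> both series
    share it and it is half of a coefficient of \<open>1\<close>.\<close>
  have "?G' = ?G oo (- fps_X)"
    by (subst fps_inverse_compose) (simp_all add: fps_compose_add_distrib)
  then have "fps_nth ?G' k = (-1) ^ k * fps_nth ?G k"
    by (simp add: fps_compose_uminus')
  then have "2 * fps_nth ?G k = fps_nth (?G + ?G') k"
    using assms by simp
  also have "\<dots> = 0"
    using assms by (simp only: sum1) simp
  finally show ?thesis
    by (simp add: boole_coeff_conv_fps)
qed

section \<open>Derivatives of the power function and the Boole remainder\<close>

text \<open>The derivative of order \<open>k\<close> of \<open>x powr (- s)\<close> in
  \<open>x\<close>, in closed form so that holomorphy in \<open>s\<close> and the size in
  \<open>x\<close> can be read off.\<close>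

definition powr_deriv :: "nat \<Rightarrow> complex \<Rightarrow> complex \<Rightarrow> complex" where
  "powr_deriv k s x = (-1) ^ k * pochhammer s k * x powr (- s - of_nat k)"

lemma powr_deriv_0 [simp]: "powr_deriv 0 s x = x powr (- s)"
  by (simp add: powr_deriv_def)

lemma has_field_derivative_powr_deriv:
  assumes "x \<notin> \<real>\<^sub>\<le>\<^sub>0"
  shows "(powr_deriv k s has_field_derivative powr_deriv (Suc k) s x) (at x within A)"
proof -
  have "((\<lambda>x. (-1) ^ k * pochhammer s k * x powr (- s - of_nat k)) has_field_derivative
      (-1) ^ k * pochhammer s k * ((- s - of_nat k) * x powr (- s - of_nat k - 1))) (at x within A)"
    by (rule DERIV_cmult, rule has_field_derivative_at_within, rule has_field_derivative_powr)
      (use assms in simp)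
  moreover have "(-1) ^ k * pochhammer s k * ((- s - of_nat k) * x powr (- s - of_nat k - 1))
      = powr_deriv (Suc k) s x"
    by (simp add: powr_deriv_def pochhammer_Suc algebra_simps)
  ultimately show ?thesis
    by (simp add: powr_deriv_def[abs_def])
qed

lemma holomorphic_on_pochhammer: "(\<lambda>s. pochhammer s k) holomorphic_on A"
  by (induction k) (auto simp: pochhammer_Suc intro!: holomorphic_intros)

lemma holomorphic_on_powr_deriv: "(\<lambda>s. powr_deriv k s x) holomorphic_on A"
  unfolding powr_deriv_def by (intro holomorphic_intros holomorphic_on_pochhammer)

definition boole_sum :: "nat \<Rightarrow> complex \<Rightarrow> complex \<Rightarrow> complex" where
  "boole_sum N s x = (\<Sum>k\<le>N. boole_coeff k * powr_deriv k s x)"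

definition boole_rem :: "nat \<Rightarrow> complex \<Rightarrow> complex \<Rightarrow> complex" where
  "boole_rem N s x = x powr (- s) - boole_sum N s x - boole_sum N s (x + 1)"

lemma holomorphic_on_boole_sum: "(\<lambda>s. boole_sum N s x) holomorphic_on A"
  unfolding boole_sum_def by (intro holomorphic_intros holomorphic_on_powr_deriv)

lemma holomorphic_on_boole_rem: "(\<lambda>s. boole_rem N s x) holomorphic_on A"
  unfolding boole_rem_def by (intro holomorphic_intros holomorphic_on_boole_sum)

text \<open>The weight \<open>1 / fact (N - k)\<close> comes from the Taylor remainder of order
  \<open>N - k\<close> of the derivative of order \<open>k\<close>.\<close>

definition boole_const :: "nat \<Rightarrow> real" where
  "boole_const N = (\<Sum>k\<le>N. norm (boole_coeff k) / fact (N - k))"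

lemma boole_const_nonneg: "boole_const N \<ge> 0"
  by (auto simp: boole_const_def intro!: sum_nonneg)

text \<open>After Taylor expansion of \<open>boole_sum N s (x + 1)\<close> around \<open>x\<close>, the recurrence for the
  coefficients cancels everything except the Taylor remainders.\<close>

lemma norm_boole_rem_le:
  assumes B: "\<And>u. u \<in> closed_segment x (x + 1) \<Longrightarrow> norm (powr_deriv (Suc N) s u) \<le> B"
    and x: "\<And>u. u \<in> closed_segment x (x + 1) \<Longrightarrow> u \<notin> \<real>\<^sub>\<le>\<^sub>0"
  shows "norm (boole_rem N s x) \<le> boole_const N * B"
proof -
  \<comment> \<open>The derivative of order \<open>k\<close> is expanded only to order
    \<open>N - k\<close>. All Taylor polynomials then stop at derivative \<open>N\<close>, and every
    remainder is controlled by derivative \<open>Suc N\<close>, to which the single bound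
    \<open>B\<close> applies.\<close>
  define R where "R k = powr_deriv k s (x + 1) - (\<Sum>j\<le>N - k. powr_deriv (k + j) s x / fact j)" for k
  have R: "norm (R k) \<le> B / fact (N - k)" if "k \<le> N" for k
  proof -
    have "norm (powr_deriv (k + 0) s (x + 1)
        - (\<Sum>i\<le>N - k. powr_deriv (k + i) s x * (x + 1 - x) ^ i / fact i))
        \<le> B * norm (x + 1 - x) ^ Suc (N - k) / fact (N - k)"
      using that B x
      by (intro complex_Taylor[of "closed_segment x (x + 1)" "N - k" "\<lambda>i. powr_deriv (k + i) s"])
        (auto intro!: has_field_derivative_powr_deriv)
    then show ?thesis
      by (simp add: R_def)
  qed
  have "(\<Sum>k\<le>N. \<Sum>j\<le>N - k. boole_coeff k * (powr_deriv (k + j) s x / fact j))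
      = (\<Sum>k\<le>N. \<Sum>m=k..N. boole_coeff k / fact (m - k) * powr_deriv m s x)"
  proof (rule sum.cong[OF refl])
    fix k assume "k \<in> {..N}"
    then show "(\<Sum>j\<le>N - k. boole_coeff k * (powr_deriv (k + j) s x / fact j))
      = (\<Sum>m=k..N. boole_coeff k / fact (m - k) * powr_deriv m s x)"
      by (intro sum.reindex_bij_witness[of _ "\<lambda>m. m - k" "\<lambda>j. j + k"]) (auto simp: add_ac)
  qed
  also have "\<dots> = (\<Sum>m\<le>N. \<Sum>k\<le>m. boole_coeff k / fact (m - k) * powr_deriv m s x)"
    by (simp add: sum.Sigma)
      (rule sum.reindex_bij_witness[of _ "\<lambda>(m, k). (k, m)" "\<lambda>(k, m). (m, k)"]; auto)
  also have "\<dots> = (\<Sum>m\<le>N. (\<Sum>k\<le>m. boole_coeff k / fact (m - k)) * powr_deriv m s x)"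
    by (simp add: sum_distrib_right)
  \<comment> \<open>With the double sum ordered by \<open>m = k + j\<close>, the recurrence
    evaluates the inner sum: its \<open>1\<close> at \<open>m = 0\<close> produces
    \<open>x powr (- s)\<close>, the rest \<open>- boole_sum N s x\<close>.\<close>
  also have "\<dots> = (\<Sum>m\<le>N. (if m = 0 then powr_deriv 0 s x else 0) - boole_coeff m * powr_deriv m s x)"
  proof (intro sum.cong refl)
    fix m
    have "(\<Sum>k\<le>m. boole_coeff k / fact (m - k)) = (if m = 0 then 1 else 0) - boole_coeff m"
      using boole_coeff_rec[of m] by (simp add: eq_diff_eq)
    then show "(\<Sum>k\<le>m. boole_coeff k / fact (m - k)) * powr_deriv m s x
        = (if m = 0 then powr_deriv 0 s x else 0) - boole_coeff m * powr_deriv m s x"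
      by (simp add: left_diff_distrib)
  qed
  also have "\<dots> = x powr (- s) - boole_sum N s x"
    by (simp add: sum_subtractf boole_sum_def)
  finally have "boole_rem N s x = - (\<Sum>k\<le>N. boole_coeff k * R k)"
    by (simp add: boole_rem_def boole_sum_def[of N s "x + 1"] R_def right_diff_distrib
        sum_subtractf sum_distrib_left)
  also have "norm \<dots> \<le> (\<Sum>k\<le>N. norm (boole_coeff k * R k))"
    by (simp add: sum_norm_le)
  also have "\<dots> \<le> (\<Sum>k\<le>N. norm (boole_coeff k) * (B / fact (N - k)))"
    unfolding norm_mult by (intro sum_mono mult_left_mono R) auto
  also have "\<dots> = boole_const N * B"
    by (simp add: boole_const_def sum_distrib_right)
  finally show ?thesis .
qed

section \<open>Geometry of the sector and decay along real shifts\<close>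

definition spread :: "real \<Rightarrow> complex \<Rightarrow> bool" where
  "spread c q \<longleftrightarrow> c > 0 \<and> q \<noteq> 0 \<and> (\<forall>r\<ge>0. c * (norm q + r) \<le> norm (q + of_real r))"

text \<open>The constant is \<open>sin (\<delta> / 2)\<close>. By the law of cosines with
  \<open>cos (Arg q) \<ge> - cos \<delta>\<close>, the claim reduces to dropping a nonnegative
  multiple of \<open>(norm q - r)\<^sup>2\<close>.\<close>

lemma spread_sector:
  assumes \<delta>: "0 < \<delta>" "\<delta> \<le> pi" and q: "q \<noteq> 0" "\<bar>Arg q\<bar> \<le> pi - \<delta>"
  shows "spread (sqrt ((1 - cos \<delta>) / 2)) q"
proof -
  have "cos \<delta> < cos 0"
    using \<delta> by (intro cos_monotone_0_pi) auto
  then have lt: "cos \<delta> < 1" by simp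
  have "cos (pi - \<delta>) \<le> cos \<bar>Arg q\<bar>"
    using \<delta> q by (intro cos_monotone_0_pi_le) auto
  then have arg: "- cos \<delta> \<le> cos (Arg q)"
    by (simp add: abs_if split: if_splits)
  have "sqrt ((1 - cos \<delta>) / 2) * (norm q + r) \<le> norm (q + of_real r)" if r: "r \<ge> 0" for r
  proof (rule power2_le_imp_le)
    have "Re q = norm q * cos (Arg q)"
      using q by (simp add: cos_Arg)
    then have re: "2 * norm q * r * cos (Arg q) = 2 * Re q * r"
      by (simp only: mult_ac)
    have "(sqrt ((1 - cos \<delta>) / 2) * (norm q + r))\<^sup>2 = (1 - cos \<delta>) / 2 * (norm q + r)\<^sup>2"
      using lt by (simp add: power_mult_distrib)
    also have "\<dots> = (norm q)\<^sup>2 + r\<^sup>2 - 2 * norm q * r * cos \<delta> - (1 + cos \<delta>) / 2 * (norm q - r)\<^sup>2"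
      by (simp add: field_simps power2_eq_square)
    also have "\<dots> \<le> (norm q)\<^sup>2 + r\<^sup>2 - 2 * norm q * r * cos \<delta>"
    proof -
      have "0 \<le> (1 + cos \<delta>) / 2"
        using cos_ge_minus_one[of \<delta>] by (smt (verit) divide_nonneg_nonneg)
      then have "0 \<le> (1 + cos \<delta>) / 2 * (norm q - r)\<^sup>2"
        by (rule mult_nonneg_nonneg) simp
      then show ?thesis by linarith
    qed
    also have "\<dots> \<le> (norm q)\<^sup>2 + r\<^sup>2 + 2 * norm q * r * cos (Arg q)"
      using mult_left_mono[OF arg, of "2 * norm q * r"] r by simp
    also have "\<dots> = (norm (q + of_real r))\<^sup>2"
    proof -
      have "(norm (q + of_real r))\<^sup>2 = (Re q)\<^sup>2 + (Im q)\<^sup>2 + r\<^sup>2 + 2 * Re q * r"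
        unfolding cmod_power2 by (simp add: power2_eq_square algebra_simps)
      also have "\<dots> = (norm q)\<^sup>2 + r\<^sup>2 + 2 * norm q * r * cos (Arg q)"
        unfolding cmod_power2[of q] re by simp
      finally show ?thesis ..
    qed
    finally show "(sqrt ((1 - cos \<delta>) / 2) * (norm q + r))\<^sup>2 \<le> (norm (q + of_real r))\<^sup>2" .
  qed auto
  with lt q show ?thesis
    by (simp add: spread_def)
qed

lemma spread_notin_nonpos_Reals:
  assumes "spread c q" "r \<ge> 0"
  shows "q + of_real r \<notin> \<real>\<^sub>\<le>\<^sub>0"
proof
  assume "q + of_real r \<in> \<real>\<^sub>\<le>\<^sub>0"
  \<comment> \<open>A value \<open>- t\<close> on the cut would make the further shift by
    \<open>r + t\<close> hit \<open>0\<close>, against the positive lower bound.\<close>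
  then obtain t where t: "t \<ge> 0" "q + of_real (r + t) = 0"
    by (auto elim!: nonpos_Reals_cases simp: add.assoc[symmetric])
      (metis add.right_inverse neg_0_le_iff_le of_real_minus)
  then have "c * (norm q + (r + t)) \<le> norm (q + of_real (r + t))"
    using assms unfolding spread_def by (meson add_nonneg_nonneg)
  moreover have "c * (norm q + (r + t)) > 0"
    using assms t unfolding spread_def by (intro mult_pos_pos add_pos_nonneg) auto
  ultimately show False
    using t by simp
qed

text \<open>A complex exponent contributes the factor \<open>exp (Im s * Arg x)\<close> to the norm;
  \<open>exp (pi * \<bar>Im s\<bar>)\<close> bounds it independently of \<open>x\<close>.\<close>

lemma norm_powr_deriv_le:
  "norm (powr_deriv k s x)
    \<le> norm (pochhammer s k) * exp (pi * \<bar>Im s\<bar>) * norm x powr (- (Re s + real k))"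
proof -
  have "\<bar>Arg x\<bar> \<le> pi"
    using Arg_le_pi[of x] mpi_less_Arg[of x] by linarith
  then have "\<bar>Im s\<bar> * \<bar>Arg x\<bar> \<le> \<bar>Im s\<bar> * pi"
    by (intro mult_left_mono) auto
  then have "Im s * Arg x \<le> pi * \<bar>Im s\<bar>"
    by (simp add: abs_mult[symmetric] mult.commute)
  then have "norm (x powr (- s - of_nat k)) \<le> norm x powr (- (Re s + real k)) * exp (pi * \<bar>Im s\<bar>)"
    by (simp add: norm_powr_complex) (intro mult_mono; simp)
  then have "norm (pochhammer s k) * norm (x powr (- s - of_nat k))
      \<le> norm (pochhammer s k) * (norm x powr (- (Re s + real k)) * exp (pi * \<bar>Im s\<bar>))"
    by (rule mult_left_mono) simp
  then show ?thesis
    by (simp add: powr_deriv_def norm_mult norm_power mult_ac)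
qed

text \<open>With nonnegative \<open>Re s + real k\<close> the bound decreases in the shift, so the
  value at \<open>r'\<close> serves for all larger \<open>r\<close>. Taking \<open>r'\<close> as the
  left end of a unit segment gives a bound for the whole segment.\<close>

lemma norm_powr_deriv_shift_le:
  assumes q: "spread c q" and r: "0 \<le> r'" "r' \<le> r" and a: "Re s + real k \<ge> 0"
  shows "norm (powr_deriv k s (q + of_real r))
    \<le> norm (pochhammer s k) * exp (pi * \<bar>Im s\<bar>) * (c * (norm q + r')) powr (- (Re s + real k))"
proof -
  let ?x = "q + of_real r"
  have pos: "0 < c * (norm q + r')"
    using assms unfolding spread_def by (intro mult_pos_pos add_pos_nonneg) auto
  have "c * (norm q + r') \<le> c * (norm q + r)"
    using assms by (simp add: spread_def)
  also have "\<dots> \<le> norm ?x"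
    using assms unfolding spread_def by simp
  finally have "norm ?x powr (- (Re s + real k)) \<le> (c * (norm q + r')) powr (- (Re s + real k))"
    using pos a by (intro powr_mono2') auto
  then show ?thesis
    by (intro order_trans[OF norm_powr_deriv_le] mult_left_mono) auto
qed

lemma norm_boole_rem_shift_le:
  assumes q: "spread c q" and a: "Re s + real N + 1 \<ge> 0"
  shows "norm (boole_rem N s (of_nat n + q)) \<le> boole_const N *
    (norm (pochhammer s (Suc N)) * exp (pi * \<bar>Im s\<bar>)
      * (c * (norm q + real n)) powr (- (Re s + real N + 1)))"
proof (rule norm_boole_rem_le)
  fix u assume u: "u \<in> closed_segment (of_nat n + q) (of_nat n + q + 1)"
  obtain t where t: "0 \<le> t" "t \<le> 1" "u = of_nat n + q + t *\<^sub>R 1"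
    using u by (auto simp: closed_segment_def algebra_simps)
  then have u_eq: "u = q + of_real (real n + t)"
    by (simp add: scaleR_conv_of_real)
  show "u \<notin> \<real>\<^sub>\<le>\<^sub>0"
    unfolding u_eq using t by (intro spread_notin_nonpos_Reals[OF q]) simp
  show "norm (powr_deriv (Suc N) s u) \<le> norm (pochhammer s (Suc N)) * exp (pi * \<bar>Im s\<bar>)
      * (c * (norm q + real n)) powr (- (Re s + real N + 1))"
    unfolding u_eq
    using norm_powr_deriv_shift_le[OF q, of "real n" "real n + t" s "Suc N"] t a
    by (simp add: add_ac)
qed

lemma filterlim_spread_at_top:
  assumes "spread c q"
  shows "filterlim (\<lambda>n. c * (norm q + real n)) at_top sequentially"
  using assms unfolding spread_def
  by (intro filterlim_tendsto_pos_mult_at_top[OF tendsto_const] filterlim_tendsto_add_at_top[OF tendsto_const]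
      filterlim_real_sequentially) auto

text \<open>Removes the boundary term of the telescoped sum. The slowest term is
  \<open>k = 0\<close>, of order \<open>n powr (- Re s)\<close>, whence
  \<open>Re s > 0\<close>.\<close>

lemma boole_sum_shift_tendsto_0:
  assumes q: "spread c q" and s: "Re s > 0"
  shows "(\<lambda>n. boole_sum N s (of_nat n + q)) \<longlonglongrightarrow> 0"
proof -
  have "(\<lambda>n. powr_deriv k s (of_nat n + q)) \<longlonglongrightarrow> 0" for k
  proof (rule Lim_null_comparison)
    show "\<forall>\<^sub>F n in sequentially. norm (powr_deriv k s (of_nat n + q))
      \<le> norm (pochhammer s k) * exp (pi * \<bar>Im s\<bar>) * (c * (norm q + real n)) powr (- (Re s + real k))"
      using norm_powr_deriv_shift_le[OF q, of "real n" "real n" s k for n] s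
      by (intro always_eventually allI) (simp add: add.commute)
    have "(\<lambda>n. (c * (norm q + real n)) powr (- (Re s + real k))) \<longlonglongrightarrow> 0"
      using s by (intro tendsto_neg_powr filterlim_spread_at_top q) auto
    then show "(\<lambda>n. norm (pochhammer s k) * exp (pi * \<bar>Im s\<bar>)
        * (c * (norm q + real n)) powr (- (Re s + real k))) \<longlonglongrightarrow> 0"
      by (rule tendsto_mult_right_zero)
  qed
  then show ?thesis
    unfolding boole_sum_def by (intro tendsto_null_sum tendsto_mult_right_zero)
qed

section \<open>The series of remainders\<close>

definition boole_tail :: "nat \<Rightarrow> complex \<Rightarrow> complex \<Rightarrow> complex" where
  "boole_tail N s q = (\<Sum>n. (-1) ^ n * boole_rem N s (of_nat n + q))"

text \<open>On this half-plane the decay exponent \<open>Re s + real N + 1\<close> exceeds 2, so a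
  multiple of \<open>1 / n\<^sup>2\<close> is a majorant, uniformly on a small disc around
  \<open>s\<close>. Both convergence and holomorphy of the tail rest on it.\<close>

lemma boole_rem_locally_dominated:
  assumes q: "spread c q" and s: "Re s > 1 - real N"
  obtains d M where "d > 0" "cball s d \<subseteq> {s. Re s > 1 - real N}" "summable M"
    "\<forall>\<^sub>F n in sequentially. \<forall>z\<in>cball s d. norm ((-1) ^ n * boole_rem N z (of_nat n + q)) \<le> M n"
proof -
  have c: "c > 0" using q by (simp add: spread_def)
  obtain d where d: "d > 0" "cball s d \<subseteq> {s. Re s > 1 - real N}"
    using open_contains_cball[THEN iffD1, OF open_halfspace_Re_gt[of "1 - real N"]] s by blast
  have "continuous_on (cball s d) (\<lambda>z. norm (pochhammer z (Suc N)) * exp (pi * \<bar>Im z\<bar>))"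
    by (intro continuous_intros holomorphic_on_imp_continuous_on[OF holomorphic_on_pochhammer])
  then have "bounded ((\<lambda>z. norm (pochhammer z (Suc N)) * exp (pi * \<bar>Im z\<bar>)) ` cball s d)"
    by (intro compact_imp_bounded compact_continuous_image compact_cball)
  then obtain P where P: "\<And>z. z \<in> cball s d \<Longrightarrow> norm (pochhammer z (Suc N)) * exp (pi * \<bar>Im z\<bar>) \<le> P"
    unfolding bounded_iff by fastforce
  define M where "M n = boole_const N * (P * (1 / c\<^sup>2)) * inverse (real n ^ 2)" for n
  have "summable M"
    unfolding M_def by (intro summable_mult inverse_power_summable) auto
  \<comment> \<open>Replacing the exponent by \<open>- 2\<close> requires a base of at least 1,
    which can fail for small \<open>n\<close>; hence a domination that holds only
    eventually.\<close>
  moreover have "\<forall>\<^sub>F n in sequentially. 1 \<le> c * (norm q + real n)"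
    using filterlim_spread_at_top[OF q] by (simp add: filterlim_at_top)
  then have "\<forall>\<^sub>F n in sequentially. \<forall>z\<in>cball s d. norm ((-1) ^ n * boole_rem N z (of_nat n + q)) \<le> M n"
    using eventually_gt_at_top[of 0]
  proof (eventually_elim, intro ballI)
    fix n :: nat and z assume n: "1 \<le> c * (norm q + real n)" "n > 0" and z: "z \<in> cball s d"
    have a: "Re z > 1 - real N"
      using z d by auto
    have "(c * (norm q + real n)) powr (- (Re z + real N + 1)) \<le> (c * (norm q + real n)) powr (- 2)"
      using n a by (intro powr_mono) auto
    also have "\<dots> \<le> (c * real n) powr (- 2)"
      using n c by (intro powr_mono2') auto
    also have "\<dots> = 1 / c\<^sup>2 * inverse (real n ^ 2)"
      using n c by (simp add: powr_minus powr_numeral power_mult_distrib field_simps)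
    finally have *: "(c * (norm q + real n)) powr (- (Re z + real N + 1)) \<le> 1 / c\<^sup>2 * inverse (real n ^ 2)" .
    have "norm ((-1) ^ n * boole_rem N z (of_nat n + q)) = norm (boole_rem N z (of_nat n + q))"
      by (simp add: norm_mult norm_power)
    also have "\<dots> \<le> boole_const N * (norm (pochhammer z (Suc N)) * exp (pi * \<bar>Im z\<bar>)
      * (c * (norm q + real n)) powr (- (Re z + real N + 1)))"
      using a by (intro norm_boole_rem_shift_le q) auto
    also have "\<dots> \<le> boole_const N * (P * (1 / c\<^sup>2 * inverse (real n ^ 2)))"
    proof (intro mult_left_mono boole_const_nonneg mult_mono P z *)
      show "0 \<le> P"
        using order_trans[OF _ P[OF z]] by simp
    qed auto
    also have "\<dots> = M n"
      by (simp add: M_def)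
    finally show "norm ((-1) ^ n * boole_rem N z (of_nat n + q)) \<le> M n" .
  qed
  ultimately show thesis
    using d that by blast
qed

lemma boole_tail_sums:
  assumes "spread c q" "Re s > 1 - real N"
  shows "(\<lambda>n. (-1) ^ n * boole_rem N s (of_nat n + q)) sums boole_tail N s q"
proof -
  obtain d M where d: "d > 0" "cball s d \<subseteq> {s. Re s > 1 - real N}" and M: "summable M"
    "\<forall>\<^sub>F n in sequentially. \<forall>z\<in>cball s d. norm ((-1) ^ n * boole_rem N z (of_nat n + q)) \<le> M n"
    by (rule boole_rem_locally_dominated[OF assms])
  have "summable (\<lambda>n. (-1) ^ n * boole_rem N s (of_nat n + q))"
    using M d by (intro summable_comparison_test_ev[OF _ M(1)]) (auto elim!: eventually_mono)
  then show ?thesis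
    unfolding boole_tail_def by (rule summable_sums)
qed

lemma holomorphic_on_boole_tail:
  assumes "spread c q"
  shows "(\<lambda>s. boole_tail N s q) holomorphic_on {s. Re s > 1 - real N}"
proof (rule holomorphic_uniform_sequence)
  show "open {s. Re s > 1 - real N}"
    by (rule open_halfspace_Re_gt)
  show "(\<lambda>s. \<Sum>i<n. (-1) ^ i * boole_rem N s (of_nat i + q)) holomorphic_on {s. Re s > 1 - real N}" for n
    by (intro holomorphic_intros holomorphic_on_boole_rem)
  fix s assume s: "s \<in> {s. Re s > 1 - real N}"
  obtain d M where "d > 0" "cball s d \<subseteq> {s. Re s > 1 - real N}" "summable M"
    "\<forall>\<^sub>F n in sequentially. \<forall>z\<in>cball s d. norm ((-1) ^ n * boole_rem N z (of_nat n + q)) \<le> M n"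
    by (rule boole_rem_locally_dominated[OF assms, of N s]) (use s in auto)
  then show "\<exists>d>0. cball s d \<subseteq> {s. Re s > 1 - real N} \<and> uniform_limit (cball s d)
      (\<lambda>n s. \<Sum>i<n. (-1) ^ i * boole_rem N s (of_nat i + q)) (\<lambda>s. boole_tail N s q) sequentially"
    unfolding boole_tail_def by (intro exI[of _ d] conjI Weierstrass_m_test_ev)
qed

section \<open>Telescoping and analytic continuation\<close>

text \<open>The definition of \<open>boole_rem\<close> writes each term as
  \<open>T x + T (x + 1) + R x\<close> with \<open>x = of_nat n + q\<close>; under alternating signs
  the \<open>T\<close> parts collapse to the two ends.\<close>

lemma boole_telescope:
  "(\<Sum>n<m. (-1) ^ n / (of_nat n + q) powr s) = boole_sum N s q - (-1) ^ m * boole_sum N s (of_nat m + q)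
     + (\<Sum>n<m. (-1) ^ n * boole_rem N s (of_nat n + q))"
proof (induction m)
  case (Suc m)
  have "(-1) ^ m / (of_nat m + q) powr s = (-1) ^ m * (of_nat m + q) powr (- s)"
    by (simp add: powr_minus divide_inverse)
  with Suc show ?case
    by (simp add: boole_rem_def algebra_simps)
qed simp

lemma boole_sums:
  assumes q: "spread c q" and N: "N \<ge> 1" and s: "Re s > 0"
  shows "(\<lambda>n. (-1) ^ n / (of_nat n + q) powr s) sums (boole_sum N s q + boole_tail N s q)"
proof -
  have "(\<lambda>m. (-1) ^ m * boole_sum N s (of_nat m + q)) \<longlonglongrightarrow> 0"
    using tendsto_norm_zero[OF boole_sum_shift_tendsto_0[OF q s, of N]]
    by (subst tendsto_norm_zero_iff[symmetric]) (simp add: norm_mult norm_power)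
  moreover have "(\<lambda>n. (-1) ^ n * boole_rem N s (of_nat n + q)) sums boole_tail N s q"
    using N s by (intro boole_tail_sums[OF q]) simp
  ultimately have "(\<lambda>m. boole_sum N s q - (-1) ^ m * boole_sum N s (of_nat m + q)
     + (\<Sum>n<m. (-1) ^ n * boole_rem N s (of_nat n + q))) \<longlonglongrightarrow> boole_sum N s q - 0 + boole_tail N s q"
    unfolding sums_def by (intro tendsto_intros)
  then show ?thesis
    by (simp add: sums_def boole_telescope[where N = N])
qed

text \<open>The expressions for different \<open>N\<close> have the same alternating series as value
  on \<open>Re z > 0\<close>, hence agree wherever their half-planes overlap. These half-planes
  exhaust the plane, so the pieces glue to an entire function, and uniqueness of the continuation
  applies.\<close>

lemma alt_hurwitz_zeta_eq:
  assumes q: "spread c q" and N: "N \<ge> 1" "Re s > 1 - real N"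
  shows "alt_hurwitz_zeta s q = boole_sum N s q + boole_tail N s q"
proof -
  define F where "F n z = boole_sum n z q + boole_tail n z q" for n z
  define H where "H n = {z. Re z > 1 - real n}" for n
  \<comment> \<open>The index depends on \<open>z\<close> so that \<open>z\<close> always lies in
    the half-plane of its own piece; the \<open>+ 1\<close> keeps the index at least 1.\<close>
  define G where "G z = F (nat \<lceil>2 - Re z\<rceil> + 1) z" for z
  have holo: "F n holomorphic_on H n" for n
    unfolding F_def H_def by (intro holomorphic_intros holomorphic_on_boole_sum holomorphic_on_boole_tail[OF q])
  have open_H: "open (H n)" for n
    by (simp add: H_def open_halfspace_Re_gt)
  have eq: "F m z = F n z" if "m \<ge> 1" "n \<ge> 1" "z \<in> H m" "z \<in> H n" for m n z
  proof (rule analytic_continuation_open[of "{z. Re z > 0}" "H m \<inter> H n" "F m" "F n"])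
    show "open (H m \<inter> H n)" by (intro open_Int open_H)
    show "connected (H m \<inter> H n)"
      unfolding H_def by (intro convex_connected convex_Int convex_halfspace_Re_gt)
    show "open {z. Re z > 0}" by (simp add: open_halfspace_Re_gt)
    show "{z. Re z > 0} \<noteq> {}" by (auto intro: exI[of _ 1])
    show "{z. Re z > 0} \<subseteq> H m \<inter> H n"
      using that by (auto simp: H_def)
    show "F m w = F n w" if "w \<in> {z. Re z > 0}" for w
      using boole_sums[OF q \<open>m \<ge> 1\<close>] boole_sums[OF q \<open>n \<ge> 1\<close>] that sums_unique2
      unfolding F_def by blast
  qed (use that holo in \<open>auto intro: holomorphic_on_subset\<close>)
  have mem: "z \<in> H (nat \<lceil>2 - Re z\<rceil> + 1)" for z
    unfolding H_def by simp linarith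
  have G_eq: "G z = F n z" if "n \<ge> 1" "z \<in> H n" for n z
    unfolding G_def using that mem by (intro eq) auto
  have "G holomorphic_on (\<Union>n\<in>{1..}. H n)"
  proof (intro holomorphic_on_UN_open open_H)
    fix n :: nat assume "n \<in> {1..}"
    then show "G holomorphic_on H n"
      using holo[of n] G_eq by (subst holomorphic_cong[OF refl]) auto
  qed
  moreover have "(\<Union>n\<in>{1..}. H n) = UNIV"
    using mem by (auto intro!: bexI[of _ "nat \<lceil>2 - Re z\<rceil> + 1" for z])
  ultimately have "alt_hurwitz_zeta s q = G s"
  proof (intro alt_hurwitz_zeta_eqI)
    show "(\<lambda>n. (-1) ^ n / (of_nat n + q) powr z) sums G z" if "Re z > 0" for z
      using boole_sums[OF q _ that, of 1] that by (subst G_eq[of 1]) (auto simp: F_def H_def)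
  qed simp
  also have "\<dots> = F N s"
    using N by (intro G_eq) (auto simp: H_def)
  finally show ?thesis
    by (simp add: F_def)
qed

section \<open>Decay in \<open>q\<close> and the asymptotic expansion\<close>

lemma summable_inverse_Suc_squares:
  "summable (\<lambda>n. inverse (real (Suc n) ^ 2))"
  by (subst summable_Suc_iff) (intro inverse_power_summable; simp)

text \<open>Two of the \<open>Re s + real N + 1\<close> powers of \<open>norm q + real n\<close> pay
  for summation over \<open>n\<close>; the others are kept as powers of \<open>norm q\<close>. Since
  \<open>norm q \<ge> 1\<close>, the sum \<open>norm q + real n\<close> is at least both
  \<open>norm q\<close> and \<open>real (Suc n)\<close>.\<close>

lemma norm_boole_tail_le:
  assumes q: "spread c q" and s: "Re s > 1 - real N" and q1: "norm q \<ge> 1"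
  shows "norm (boole_tail N s q) \<le> boole_const N * (norm (pochhammer s (Suc N)) * exp (pi * \<bar>Im s\<bar>)
    * (c powr (- (Re s + real N + 1)) * (\<Sum>n. inverse (real (Suc n) ^ 2)))) * norm q powr (- (Re s + real N - 1))"
proof -
  have c: "c > 0" using q by (simp add: spread_def)
  define A where "A = boole_const N * (norm (pochhammer s (Suc N)) * exp (pi * \<bar>Im s\<bar>)
    * c powr (- (Re s + real N + 1))) * norm q powr (- (Re s + real N - 1))"
  have sm: "summable (\<lambda>n. A * inverse (real (Suc n) ^ 2))"
    by (intro summable_mult summable_inverse_Suc_squares)
  have le: "norm ((-1) ^ n * boole_rem N s (of_nat n + q)) \<le> A * inverse (real (Suc n) ^ 2)" for n
  proof -
    have "(norm q + real n) powr (- (Re s + real N - 1) + (- 2))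
        \<le> norm q powr (- (Re s + real N - 1)) * real (Suc n) powr (- 2)"
      unfolding powr_add using q1 s by (intro mult_mono powr_mono2') auto
    then have "c powr (- (Re s + real N + 1)) * (norm q + real n) powr (- (Re s + real N + 1))
        \<le> c powr (- (Re s + real N + 1)) * (norm q powr (- (Re s + real N - 1)) * inverse (real (Suc n) ^ 2))"
      by (intro mult_left_mono) (simp_all add: powr_minus algebra_simps)
    then have *: "(c * (norm q + real n)) powr (- (Re s + real N + 1))
        \<le> c powr (- (Re s + real N + 1)) * (norm q powr (- (Re s + real N - 1)) * inverse (real (Suc n) ^ 2))"
      using c by (simp add: powr_mult)
    have "norm ((-1) ^ n * boole_rem N s (of_nat n + q)) = norm (boole_rem N s (of_nat n + q))"
      by (simp add: norm_mult norm_power)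
    also have "\<dots> \<le> boole_const N * (norm (pochhammer s (Suc N)) * exp (pi * \<bar>Im s\<bar>)
      * (c * (norm q + real n)) powr (- (Re s + real N + 1)))"
      using s by (intro norm_boole_rem_shift_le q) auto
    also have "\<dots> \<le> boole_const N * (norm (pochhammer s (Suc N)) * exp (pi * \<bar>Im s\<bar>)
      * (c powr (- (Re s + real N + 1)) * (norm q powr (- (Re s + real N - 1)) * inverse (real (Suc n) ^ 2))))"
      by (intro mult_left_mono * boole_const_nonneg) auto
    finally show ?thesis
      by (simp add: A_def mult_ac)
  qed
  have "norm (boole_tail N s q) \<le> (\<Sum>n. A * inverse (real (Suc n) ^ 2))"
    unfolding boole_tail_def by (rule norm_suminf_le[OF le sm])
  also have "\<dots> = A * (\<Sum>n. inverse (real (Suc n) ^ 2))"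
    by (rule suminf_mult[OF summable_inverse_Suc_squares])
  finally show ?thesis
    by (simp add: A_def mult_ac)
qed

text \<open>Even coefficients of positive index vanish, so each step of \<open>L\<close> adds one
  odd term. The indices 0 and 1 give the two explicit terms, the second positive because both
  \<open>boole_coeff 1\<close> and the first derivative carry a minus sign.\<close>

lemma boole_sum_odd:
  "boole_sum (2 * L + 1) s q = 1 / 2 * q powr (- s) + 1 / 4 * s * q powr (- s - 1)
     + (\<Sum>k=1..L. boole_coeff (2 * k + 1) * powr_deriv (2 * k + 1) s q)"
proof (induction L)
  case 0
  show ?case
    by (simp add: boole_sum_def boole_coeff_0 boole_coeff_1 powr_deriv_def)
next
  case (Suc L)
  have "boole_sum (2 * Suc L + 1) s q = boole_sum (2 * L + 1) s q
      + boole_coeff (2 * Suc L) * powr_deriv (2 * Suc L) s q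
      + boole_coeff (2 * Suc L + 1) * powr_deriv (2 * Suc L + 1) s q"
    by (simp add: boole_sum_def)
  with Suc show ?case
    by (simp add: boole_coeff_even)
qed

lemma boole_term_odd:
  assumes "q \<noteq> 0"
  shows "boole_coeff (2 * k + 1) * powr_deriv (2 * k + 1) s q
    = - (1 / 2 * q powr (- s) * (euler_poly (2 * k + 1) 0 / fact (2 * k + 1)
                * (pochhammer s (2 * k + 1) / q ^ (2 * k + 1))))"
proof -
  have "q powr (- s - of_nat (2 * k + 1)) = q powr (- s) / q powr (of_nat (2 * k + 1))"
    by (rule powr_diff)
  also have "\<dots> = q powr (- s) / q ^ (2 * k + 1)"
    using assms by (subst powr_complexpow) simp_all
  finally show ?thesis
    unfolding boole_coeff_def powr_deriv_def by (simp add: mult_ac)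
qed

theorem theorem3p1:
  fixes s :: complex and \<delta> :: real
  assumes "\<delta> > 0"
  shows "\<forall>K::nat.
    (\<lambda>q. norm (alt_hurwitz_zeta s q
        - (1 / 2 * q powr (- s) + 1 / 4 * s * q powr (- s - 1)
           - 1 / 2 * q powr (- s) *
             (\<Sum>k=1..K. euler_poly (2 * k + 1) 0 / fact (2 * k + 1)
                * (pochhammer s (2 * k + 1) / q ^ (2 * k + 1))))))
    \<in> O[sector_at_infinity \<delta>](\<lambda>q. norm q powr (- Re s - 2 * real K - 3))"
proof
  fix K :: nat
  define c where "c = sqrt ((1 - cos \<delta>) / 2)"
  \<comment> \<open>The part \<open>K + 2\<close> puts the tail below the required order, since
    \<open>N - 1 = 2 * L\<close>; the part with \<open>Re s\<close> ensures
    \<open>Re s > 1 - real N\<close>.\<close>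
  define L where "L = K + 2 + nat \<lceil>\<bar>Re s\<bar>\<rceil>"
  define N where "N = 2 * L + 1"
  define T where "T = boole_const N * (norm (pochhammer s (Suc N)) * exp (pi * \<bar>Im s\<bar>)
    * (c powr (- (Re s + real N + 1)) * (\<Sum>n. inverse (real (Suc n) ^ 2))))"
  define B where "B k = norm (boole_coeff (2 * k + 1))
    * (norm (pochhammer s (2 * k + 1)) * exp (pi * \<bar>Im s\<bar>))" for k
  have N: "N \<ge> 1" "Re s > 1 - real N" "Re s + real N - 1 \<ge> Re s + 2 * real K + 3"
  proof -
    have "real L \<ge> 2 + \<bar>Re s\<bar>"
      unfolding L_def by linarith
    then show "Re s > 1 - real N"
      unfolding N_def by linarith
  qed (simp_all add: N_def L_def)
  have "norm (alt_hurwitz_zeta s q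
        - (1 / 2 * q powr (- s) + 1 / 4 * s * q powr (- s - 1)
           - 1 / 2 * q powr (- s) *
             (\<Sum>k=1..K. euler_poly (2 * k + 1) 0 / fact (2 * k + 1)
                * (pochhammer s (2 * k + 1) / q ^ (2 * k + 1)))))
      \<le> ((\<Sum>k=K+1..L. B k) + T) * norm q powr (- Re s - 2 * real K - 3)"
    if q1: "norm q \<ge> 1" and Arg: "\<bar>Arg q\<bar> \<le> pi - \<delta>" for q
  proof -
    have q0: "q \<noteq> 0" using q1 by auto
    \<comment> \<open>The bound \<open>\<delta> \<le> pi\<close> follows from \<open>Arg\<close>, as
      \<open>\<bar>Arg q\<bar>\<close> is nonnegative; for larger \<open>\<delta>\<close> the sector
      is empty.\<close>
    have q: "spread c q"
      unfolding c_def using Arg assms q0 by (intro spread_sector) auto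
    let ?t = "\<lambda>k. boole_coeff (2 * k + 1) * powr_deriv (2 * k + 1) s q"
    have head: "- (1 / 2 * q powr (- s) * (\<Sum>k=1..K. euler_poly (2 * k + 1) 0 / fact (2 * k + 1)
                * (pochhammer s (2 * k + 1) / q ^ (2 * k + 1)))) = (\<Sum>k=1..K. ?t k)"
      unfolding boole_term_odd[OF q0] sum_negf sum_distrib_left ..
    have split: "(\<Sum>k=1..L. ?t k) = (\<Sum>k=1..K. ?t k) + (\<Sum>k=K+1..L. ?t k)"
    proof -
      have "{1..L} = {1..K} \<union> {K+1..L}" by (auto simp: L_def)
      then show ?thesis by (simp add: sum.union_disjoint)
    qed
    have cancel: "a + S + t - (a - P) = S2 + t"
      if "- P = S1" "S = S1 + S2" for a P S S1 S2 t :: complex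
      using that by (simp add: that(1)[symmetric])
    have "alt_hurwitz_zeta s q
        - (1 / 2 * q powr (- s) + 1 / 4 * s * q powr (- s - 1)
           - 1 / 2 * q powr (- s) *
             (\<Sum>k=1..K. euler_poly (2 * k + 1) 0 / fact (2 * k + 1)
                * (pochhammer s (2 * k + 1) / q ^ (2 * k + 1))))
        = (\<Sum>k=K+1..L. ?t k) + boole_tail N s q"
      unfolding alt_hurwitz_zeta_eq[OF q N(1,2)] N_def boole_sum_odd by (rule cancel[OF head split])
    \<comment> \<open>The terms with \<open>K < k \<le> L\<close> were included only to improve the
      tail. Each has order at most \<open>- Re s - 2 * real K - 3\<close>, so they belong to the
      error.\<close>
    also have "norm \<dots> \<le> (\<Sum>k=K+1..L. norm (?t k)) + norm (boole_tail N s q)"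
      by (intro norm_triangle_mono sum_norm_le order_refl)
    also have "\<dots> \<le> (\<Sum>k=K+1..L. B k * norm q powr (- Re s - 2 * real K - 3))
        + T * norm q powr (- Re s - 2 * real K - 3)"
    proof (intro add_mono sum_mono)
      fix k assume k: "k \<in> {K+1..L}"
      have "norm (powr_deriv (2 * k + 1) s q) \<le> norm (pochhammer s (2 * k + 1)) * exp (pi * \<bar>Im s\<bar>)
          * norm q powr (- Re s - 2 * real K - 3)"
        using k q1 by (intro order_trans[OF norm_powr_deriv_le] mult_left_mono powr_mono) auto
      then show "norm (?t k) \<le> B k * norm q powr (- Re s - 2 * real K - 3)"
        unfolding B_def norm_mult mult.assoc by (intro mult_left_mono) (auto simp: mult_ac)
    next
      have "norm (boole_tail N s q) \<le> T * norm q powr (- (Re s + real N - 1))"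
        unfolding T_def by (rule norm_boole_tail_le[OF q N(2) q1])
      also have "\<dots> \<le> T * norm q powr (- Re s - 2 * real K - 3)"
      proof (intro mult_left_mono powr_mono q1)
        show "0 \<le> T"
          unfolding T_def by (intro mult_nonneg_nonneg boole_const_nonneg suminf_nonneg
              summable_inverse_Suc_squares) auto
      qed (use N in auto)
      finally show "norm (boole_tail N s q) \<le> T * norm q powr (- Re s - 2 * real K - 3)" .
    qed
    also have "\<dots> = ((\<Sum>k=K+1..L. B k) + T) * norm q powr (- Re s - 2 * real K - 3)"
      by (simp add: sum_distrib_right distrib_right)
    finally show ?thesis .
  qed
  then show "(\<lambda>q. norm (alt_hurwitz_zeta s q
        - (1 / 2 * q powr (- s) + 1 / 4 * s * q powr (- s - 1)
           - 1 / 2 * q powr (- s) *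
             (\<Sum>k=1..K. euler_poly (2 * k + 1) 0 / fact (2 * k + 1)
                * (pochhammer s (2 * k + 1) / q ^ (2 * k + 1))))))
    \<in> O[sector_at_infinity \<delta>](\<lambda>q. norm q powr (- Re s - 2 * real K - 3))"
    unfolding sector_at_infinity_def
    by (intro bigoI[where c = "(\<Sum>k=K+1..L. B k) + T"])
      (auto simp: eventually_inf_principal eventually_at_infinity intro!: exI[of _ 1])
qed

end
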